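(* Let $X$ be a real Banach space, $H$ a real Hilbert space (identified with its dual), $K\subseteq H$ a nonempty closed convex set, $F:X\to X^*$ continuously differentiable and $g:X\to H$ twice continuously differentiable. Let $(\bar{x},\bar{\lambda})$ be a KKT point satisfying the local error bound. Let $\{x^k\},\{\lambda^k\},\{w^k\},\{\rho_k\}$ be sequences generated by the augmented Lagrangian method such that: (i) there is a null sequence $\{\varepsilon_k\}\subseteq[0,\infty)$ with $\|\mathcal{L}_{\rho_k}(x^{k+1},w^k)\|_{X^*}\le\varepsilon_{k+1}$ for all $k$; (ii) $(x^k,\lambda^k)\to(\bar{x},\bar{\lambda})$ strongly in $X\times H$, and $w^k=\lambda^k$ for all $k$ sufficiently large; (iii) $\varepsilon_{k+1}=o(\sigma_k)$, where $\sigma_k:=\sigma(x^k,\lambda^k)$. Then: (a) For every $q\in(0,1)$, there is a $\bar{\rho}_q>0$ such that, if $\rho_k\ge\bar{\rho}_q$ for sufficiently large $k$, then $(x^k,\lambda^k)\to(\bar{x},\bar{\lambda})$ Q-linearly with rate $q$. (b) The sequence of penalty parameters $\{\rho_k\}$ remains bounded.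
   Context: The underlying problem is the variational problem of finding $x\in M:=\{x\in X: g(x)\in K\}$ such that $\langle F(x),v\rangle\ge 0$ for all $v$ in the (Bouligand) tangent cone to $M$ at $x$. $P_K$ is the metric projection onto $K$; $g'(x)^*:H\to X^*$ is the adjoint of the Fréchet derivative $g'(x)$. For $y\in K$, $\mathcal{N}_K(y)=\{\psi\in H:(\psi,z-y)\le 0\ \forall z\in K\}$; $\mathcal{N}_K(y)=\emptyset$ if $y\notin K$. $\mathcal{L}(x,\lambda):=F(x)+g'(x)^*\lambda$. A pair $(\bar{x},\bar{\lambda})\in X\times H$ is a KKT point of the variational problem if $\mathcal{L}(\bar{x},\bar{\lambda})=0$ and $\bar{\lambda}\in\mathcal{N}_K(g(\bar{x}))$. The residual is $\sigma(x,\lambda):=\|\mathcal{L}(x,\lambda)\|_{X^*}+\|g(x)-P_K(g(x)+\lambda)\|_H$. Local error bound at $(\bar{x},\bar{\lambda})$: there are $c,\delta>0$ such that $\|x-\bar{x}\|_X+\|\lambda-\bar{\lambda}\|_H\le c\,\sigma(x,\lambda)$ for all $(x,\lambda)\in X\times H$ with $\|x-\bar{x}\|_X<\delta$ and $\sigma(x,\lambda)<\delta$. Augmented Lagrangian and utility function: for $\rho>0$, $$\mathcal{L}_\rho(x,\lambda):=F(x)+\rho\, g'(x)^*\Bigl[g(x)+\tfrac{\lambda}{\rho}-P_K\bigl(g(x)+\tfrac{\lambda}{\rho}\bigr)\Bigr]\in X^*,$$ $$V(x,\lambda,\rho):=\|\mathcal{L}_\rho(x,\lambda)\|_{X^*}+\bigl\|g(x)-P_K\bigl(g(x)+\tfrac{\lambda}{\rho}\bigr)\bigr\|_H.$$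 Augmented Lagrangian method: given $(x^0,\lambda^0)\in X\times H$, a bounded set $B\subseteq H$, $\rho_0>0$, $\gamma>1$, $\tau\in(0,1)$, for $k=0,1,2,\dots$: (1) choose $w^k\in B$ and compute an inexact zero $x^{k+1}\in X$ of $\mathcal{L}_{\rho_k}(\cdot,w^k)$ (the degree of inexactness is the one in hypothesis (i) of the claim); (2) set $\lambda^{k+1}:=\rho_k\bigl[g(x^{k+1})+\frac{w^k}{\rho_k}-P_K\bigl(g(x^{k+1})+\frac{w^k}{\rho_k}\bigr)\bigr]$; (3) if $k=0$ or $V(x^{k+1},w^k,\rho_k)\le\tau V(x^k,w^{k-1},\rho_{k-1})$, set $\rho_{k+1}:=\rho_k$, otherwise set $\rho_{k+1}:=\gamma\rho_k$. The method is assumed to generate infinite sequences (no termination). $\varepsilon_{k+1}=o(\sigma_k)$ means there is a null sequence $z_k\ge 0$ with $\varepsilon_{k+1}\le z_k\sigma_k$ for all sufficiently large $k$. Q-linear convergence with rate $q$ means $\|x^{k+1}-\bar{x}\|_X+\|\lambda^{k+1}-\bar{\lambda}\|_H\le q\,(\|x^k-\bar{x}\|_X+\|\lambda^k-\bar{\lambda}\|_H)$ for all sufficiently large $k$. *)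

theory Defs
  imports "HOL-Analysis.Analysis"
begin

definition continuously_differentiable ::
  "('a::real_normed_vector \<Rightarrow> 'b::real_normed_vector) \<Rightarrow> bool" where
  "continuously_differentiable f \<longleftrightarrow>
     (\<exists>f'. (\<forall>x. (f has_derivative blinfun_apply (f' x)) (at x)) \<and> continuous_on UNIV f')"

(* closest_point of the library requires the class heine_borel, hence finite dimension. *)
definition metric_proj :: "'h::real_inner set \<Rightarrow> 'h \<Rightarrow> 'h" where
  "metric_proj K y = (ARG_MIN (dist y) z. z \<in> K)"

definition normal_cone :: "'h::real_inner set \<Rightarrow> 'h \<Rightarrow> 'h set" where
  "normal_cone K y = (if y \<in> K then {\<psi>. \<forall>z\<in>K. \<psi> \<bullet> (z - y) \<le> 0} else {})"

(* The adjoint A* : H -> X*, where H is identified with its dual: (A* lam) v = (lam, A v). *)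
definition dual_adjoint ::
  "('x::real_normed_vector \<Rightarrow>\<^sub>L 'h::real_inner) \<Rightarrow> 'h \<Rightarrow> ('x \<Rightarrow>\<^sub>L real)" where
  "dual_adjoint A lam = blinfun_inner_right lam o\<^sub>L A"

(* In everything below, g' is the Frechet derivative of g. *)

definition lagr ::
  "('x::real_normed_vector \<Rightarrow> ('x \<Rightarrow>\<^sub>L real)) \<Rightarrow> ('x \<Rightarrow> ('x \<Rightarrow>\<^sub>L 'h::real_inner))
     \<Rightarrow> 'x \<Rightarrow> 'h \<Rightarrow> ('x \<Rightarrow>\<^sub>L real)" where
  "lagr F g' x lam = F x + dual_adjoint (g' x) lam"

definition KKT_point ::
  "('x::real_normed_vector \<Rightarrow> ('x \<Rightarrow>\<^sub>L real)) \<Rightarrow> ('x \<Rightarrow> 'h::real_inner)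
     \<Rightarrow> ('x \<Rightarrow> ('x \<Rightarrow>\<^sub>L 'h)) \<Rightarrow> 'h set \<Rightarrow> 'x \<Rightarrow> 'h \<Rightarrow> bool" where
  "KKT_point F g g' K x lam \<longleftrightarrow> lagr F g' x lam = 0 \<and> lam \<in> normal_cone K (g x)"

definition residual ::
  "('x::real_normed_vector \<Rightarrow> ('x \<Rightarrow>\<^sub>L real)) \<Rightarrow> ('x \<Rightarrow> 'h::real_inner)
     \<Rightarrow> ('x \<Rightarrow> ('x \<Rightarrow>\<^sub>L 'h)) \<Rightarrow> 'h set \<Rightarrow> 'x \<Rightarrow> 'h \<Rightarrow> real" where
  "residual F g g' K x lam =
     norm (lagr F g' x lam) + norm (g x - metric_proj K (g x + lam))"

(* lam is not required to be near lambar. *)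
definition local_error_bound ::
  "('x::real_normed_vector \<Rightarrow> ('x \<Rightarrow>\<^sub>L real)) \<Rightarrow> ('x \<Rightarrow> 'h::real_inner)
     \<Rightarrow> ('x \<Rightarrow> ('x \<Rightarrow>\<^sub>L 'h)) \<Rightarrow> 'h set \<Rightarrow> 'x \<Rightarrow> 'h \<Rightarrow> bool" where
  "local_error_bound F g g' K xbar lambar \<longleftrightarrow>
     (\<exists>c>0. \<exists>\<delta>>0. \<forall>x lam.
        norm (x - xbar) < \<delta> \<and> residual F g g' K x lam < \<delta> \<longrightarrow>
        norm (x - xbar) + norm (lam - lambar) \<le> c * residual F g g' K x lam)"

definition aug_lagr ::
  "('x::real_normed_vector \<Rightarrow> ('x \<Rightarrow>\<^sub>L real)) \<Rightarrow> ('x \<Rightarrow> 'h::real_inner)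
     \<Rightarrow> ('x \<Rightarrow> ('x \<Rightarrow>\<^sub>L 'h)) \<Rightarrow> 'h set \<Rightarrow> real \<Rightarrow> 'x \<Rightarrow> 'h \<Rightarrow> ('x \<Rightarrow>\<^sub>L real)" where
  "aug_lagr F g g' K \<rho> x lam =
     F x + \<rho> *\<^sub>R dual_adjoint (g' x)
       (g x + lam /\<^sub>R \<rho> - metric_proj K (g x + lam /\<^sub>R \<rho>))"

definition utility ::
  "('x::real_normed_vector \<Rightarrow> ('x \<Rightarrow>\<^sub>L real)) \<Rightarrow> ('x \<Rightarrow> 'h::real_inner)
     \<Rightarrow> ('x \<Rightarrow> ('x \<Rightarrow>\<^sub>L 'h)) \<Rightarrow> 'h set \<Rightarrow> 'x \<Rightarrow> 'h \<Rightarrow> real \<Rightarrow> real" where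
  "utility F g g' K x lam \<rho> =
     norm (aug_lagr F g g' K \<rho> x lam) + norm (g x - metric_proj K (g x + lam /\<^sub>R \<rho>))"

(* The inexactness requirement on x (Suc k) is part of alm_assumptions. *)
definition alm_sequences ::
  "('x::real_normed_vector \<Rightarrow> ('x \<Rightarrow>\<^sub>L real)) \<Rightarrow> ('x \<Rightarrow> 'h::real_inner)
     \<Rightarrow> ('x \<Rightarrow> ('x \<Rightarrow>\<^sub>L 'h)) \<Rightarrow> 'h set
     \<Rightarrow> 'h set \<Rightarrow> real \<Rightarrow> real \<Rightarrow> real
     \<Rightarrow> (nat \<Rightarrow> 'x) \<Rightarrow> (nat \<Rightarrow> 'h) \<Rightarrow> (nat \<Rightarrow> 'h) \<Rightarrow> (nat \<Rightarrow> real) \<Rightarrow> bool" where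
  "alm_sequences F g g' K B \<rho>0 \<gamma> \<tau> x lam w \<rho> \<longleftrightarrow>
     bounded B \<and> \<rho>0 > 0 \<and> \<gamma> > 1 \<and> 0 < \<tau> \<and> \<tau> < 1 \<and> \<rho> 0 = \<rho>0 \<and>
     (\<forall>k. w k \<in> B) \<and>
     (\<forall>k. lam (Suc k) = \<rho> k *\<^sub>R (g (x (Suc k)) + w k /\<^sub>R \<rho> k
                                  - metric_proj K (g (x (Suc k)) + w k /\<^sub>R \<rho> k))) \<and>
     (\<forall>k. \<rho> (Suc k) =
        (if k = 0 \<or> utility F g g' K (x (Suc k)) (w k) (\<rho> k)
                     \<le> \<tau> * utility F g g' K (x k) (w (k - 1)) (\<rho> (k - 1))
         then \<rho> k else \<gamma> * \<rho> k))"

definition alm_assumptions ::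
  "('x::real_normed_vector \<Rightarrow> ('x \<Rightarrow>\<^sub>L real)) \<Rightarrow> ('x \<Rightarrow> 'h::real_inner)
     \<Rightarrow> ('x \<Rightarrow> ('x \<Rightarrow>\<^sub>L 'h)) \<Rightarrow> 'h set \<Rightarrow> 'x \<Rightarrow> 'h
     \<Rightarrow> (nat \<Rightarrow> 'x) \<Rightarrow> (nat \<Rightarrow> 'h) \<Rightarrow> (nat \<Rightarrow> 'h) \<Rightarrow> (nat \<Rightarrow> real) \<Rightarrow> bool" where
  "alm_assumptions F g g' K xbar lambar x lam w \<rho> \<longleftrightarrow>
     (\<exists>\<epsilon> :: nat \<Rightarrow> real.
        (\<forall>k. 0 \<le> \<epsilon> k) \<and> \<epsilon> \<longlonglongrightarrow> 0 \<and>
        (\<forall>k. norm (aug_lagr F g g' K (\<rho> k) (x (Suc k)) (w k)) \<le> \<epsilon> (Suc k)) \<and>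
        (\<exists>z :: nat \<Rightarrow> real. (\<forall>k. 0 \<le> z k) \<and> z \<longlonglongrightarrow> 0 \<and>
           (\<forall>\<^sub>F k in sequentially. \<epsilon> (Suc k) \<le> z k * residual F g g' K (x k) (lam k)))) \<and>
     (\<lambda>k. (x k, lam k)) \<longlonglongrightarrow> (xbar, lambar) \<and>
     (\<forall>\<^sub>F k in sequentially. w k = lam k)"

definition Q_linear_rate ::
  "real \<Rightarrow> (nat \<Rightarrow> 'x::real_normed_vector) \<Rightarrow> (nat \<Rightarrow> 'h::real_normed_vector)
     \<Rightarrow> 'x \<Rightarrow> 'h \<Rightarrow> bool" where
  "Q_linear_rate q x lam xbar lambar \<longleftrightarrow>
     (\<forall>\<^sub>F k in sequentially.
        norm (x (Suc k) - xbar) + norm (lam (Suc k) - lambar)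
          \<le> q * (norm (x k - xbar) + norm (lam k - lambar)))"

end

theory Submission
  imports Defs
begin

text \<open>
  Everything is controlled by one chain of inequalities. Write \<open>e\<^sub>k\<close> for the distance of
  \<open>(x\<^sup>k, \<lambda>\<^sup>k)\<close> to the KKT point, \<open>\<sigma>\<^sub>k\<close> for the residual there, and \<open>V\<^sub>k\<^sub>+\<^sub>1\<close> for the utility
  \<open>V(x\<^sup>k\<^sup>+\<^sup>1, w\<^sup>k, \<rho>\<^sub>k)\<close>. The multiplier update makes the augmented Lagrangian at \<open>w\<^sup>k\<close> equal to the
  ordinary Lagrangian at \<open>\<lambda>\<^sup>k\<^sup>+\<^sup>1\<close>, and it makes the feasibility part of the utility equal to
  \<open>\<parallel>\<lambda>\<^sup>k\<^sup>+\<^sup>1 - w\<^sup>k\<parallel> / \<rho>\<^sub>k\<close>. Since \<open>\<lambda>\<^sup>k\<^sup>+\<^sup>1\<close> is moreover a normal vector at the projected point and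
  \<open>y \<mapsto> y - P\<^sub>K y\<close> is nonexpansive, the utility dominates the residual of the new iterate. For large
  \<open>k\<close>, where \<open>w\<^sup>k = \<lambda>\<^sup>k\<close>, this gives
  \<open>\<sigma>\<^sub>k\<^sub>+\<^sub>1 \<le> V\<^sub>k\<^sub>+\<^sub>1 \<le> z\<^sub>k \<sigma>\<^sub>k + (e\<^sub>k + e\<^sub>k\<^sub>+\<^sub>1) / \<rho>\<^sub>k\<close> with a null sequence \<open>z\<close>
  (lemmas \<open>residual_le_utility\<close> and \<open>utility_le\<close>).

  The residual is bounded above by a multiple of \<open>e\<^sub>k\<close>, because the data are differentiable at the
  solution (\<open>residual_le_distance\<close>), and below by the local error bound \<open>e\<^sub>k \<le> c \<sigma>\<^sub>k\<close>. Inserting both,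
  \<open>(1 - c/\<rho>\<^sub>k) e\<^sub>k\<^sub>+\<^sub>1 \<le> (c C z\<^sub>k + c/\<rho>\<^sub>k) e\<^sub>k\<close>, so that the rate is any prescribed \<open>q\<close> as soon as \<open>c/\<rho>\<^sub>k\<close>
  is small; the threshold on \<open>\<rho>\<^sub>k\<close> depends only on \<open>c\<close> and \<open>q\<close>.

  If the penalty parameters were unbounded, they would diverge, so \<open>e\<^sub>k\<^sub>+\<^sub>1 \<le> e\<^sub>k\<close> eventually
  and \<open>V\<^sub>k\<^sub>+\<^sub>1 \<le> (z\<^sub>k + 2c/\<rho>\<^sub>k) \<sigma>\<^sub>k \<le> (z\<^sub>k + 2c/\<rho>\<^sub>k) V\<^sub>k\<close>, where the factor tends to zero. The test
  \<open>V\<^sub>k\<^sub>+\<^sub>1 \<le> \<tau> V\<^sub>k\<close> would then always succeed and the parameter would never be increased again.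
\<close>

section \<open>The metric projection onto a closed convex set\<close>

text \<open>
  By the parallelogram law, two almost nearest points are close to each other: otherwise their
  midpoint, which belongs to the convex set, would be nearer than the infimal distance. Hence the
  sets of almost nearest points shrink to a point, and completeness replaces compactness.
\<close>

lemma nearest_point_exists:
  fixes K :: "'h::{real_inner, banach} set"
  assumes "K \<noteq> {}" "closed K" "convex K"
  shows "\<exists>p\<in>K. \<forall>z\<in>K. dist y p \<le> dist y z"
proof -
  define d where "d = infdist y K"
  define S where "S n = K \<inter> cball y (d + 1 / real (Suc n))" for n
  have d0: "0 \<le> d" unfolding d_def by (rule infdist_nonneg)
  have low: "d \<le> dist y z" if "z \<in> K" for z
    unfolding d_def using that by (rule infdist_le)
  have diam: "(dist a b)\<^sup>2 \<le> 4 * (2 * d * h + h\<^sup>2)"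
    if a: "a \<in> K" "dist y a \<le> d + h" and b: "b \<in> K" "dist y b \<le> d + h" for a b h
  proof -
    define m where "m = (1/2) *\<^sub>R a + (1/2) *\<^sub>R b"
    have "m \<in> K"
      unfolding m_def using \<open>convex K\<close> a(1) b(1) by (rule convexD) auto
    then have m: "d\<^sup>2 \<le> (norm (y - m))\<^sup>2"
      using low d0 by (metis dist_norm power_mono)
    have par: "(norm (a - b))\<^sup>2 = 2 * (norm (y - a))\<^sup>2 + 2 * (norm (y - b))\<^sup>2 - 4 * (norm (y - m))\<^sup>2"
      unfolding m_def
      by (simp add: power2_norm_eq_inner inner_simps inner_commute algebra_simps)
    have "(norm (y - a))\<^sup>2 \<le> (d + h)\<^sup>2" "(norm (y - b))\<^sup>2 \<le> (d + h)\<^sup>2"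
      using a(2) b(2) by (auto simp: dist_norm intro!: power_mono)
    then show ?thesis
      using par m by (simp add: dist_norm power2_sum algebra_simps)
  qed
  have "\<exists>p. \<forall>n. p \<in> S n"
  proof (rule decreasing_closed_nest[of S])
    show "closed (S n)" for n
      unfolding S_def using \<open>closed K\<close> by auto
    show "S n \<noteq> {}" for n
    proof -
      have "infdist y K < d + 1 / real (Suc n)"
        unfolding d_def by simp
      then have "\<exists>z\<in>K. dist y z < d + 1 / real (Suc n)"
        unfolding infdist_notempty[OF \<open>K \<noteq> {}\<close>]
        by (subst (asm) cINF_less_iff) (use \<open>K \<noteq> {}\<close> in \<open>auto intro: bdd_belowI2[of _ 0]\<close>)
      then show ?thesis unfolding S_def by (auto intro: less_imp_le)
    qed
    show "S n \<subseteq> S m" if "m \<le> n" for m n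
    proof -
      have "1 / real (Suc n) \<le> 1 / real (Suc m)"
        using that by (intro divide_left_mono) auto
      then show ?thesis unfolding S_def by auto
    qed
    show "\<exists>n. \<forall>a\<in>S n. \<forall>b\<in>S n. dist a b < r" if "r > 0" for r
    proof -
      have "(\<lambda>n. 4 * (2 * d * (1 / real (Suc n)) + (1 / real (Suc n))\<^sup>2)) \<longlonglongrightarrow>
              4 * (2 * d * 0 + 0\<^sup>2)"
        by (intro tendsto_intros LIMSEQ_Suc[OF lim_1_over_n])
      then have "\<forall>\<^sub>F n in sequentially.
              4 * (2 * d * (1 / real (Suc n)) + (1 / real (Suc n))\<^sup>2) < r\<^sup>2"
        by (rule order_tendstoD) (use that in auto)
      then obtain n where n: "4 * (2 * d * (1 / real (Suc n)) + (1 / real (Suc n))\<^sup>2) < r\<^sup>2"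
        by (auto simp: eventually_sequentially)
      have "dist a b < r" if "a \<in> S n" "b \<in> S n" for a b
      proof -
        have "(dist a b)\<^sup>2 < r\<^sup>2"
          using diam[of a "1 / real (Suc n)" b] that n unfolding S_def by auto
        then show ?thesis using \<open>r > 0\<close> by (simp add: power_less_imp_less_base)
      qed
      then show ?thesis by blast
    qed
  qed blast
  then obtain p where p: "\<And>n. p \<in> S n" by blast
  have "dist y p \<le> d"
  proof (rule LIMSEQ_le_const)
    show "(\<lambda>n. d + 1 / real (Suc n)) \<longlonglongrightarrow> d"
      using tendsto_add[OF tendsto_const[of d] LIMSEQ_Suc[OF lim_1_over_n]] by simp
    show "\<exists>N. \<forall>n\<ge>N. dist y p \<le> d + 1 / real (Suc n)"
      using p unfolding S_def by auto
  qed
  then show ?thesis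
    using p low unfolding S_def by (meson IntD1 order_trans)
qed

lemma metric_proj_in_and_nearest:
  fixes K :: "'h::{real_inner, banach} set"
  assumes "K \<noteq> {}" "closed K" "convex K"
  shows "metric_proj K y \<in> K \<and> (\<forall>z\<in>K. dist y (metric_proj K y) \<le> dist y z)"
proof -
  obtain p where "p \<in> K" "\<forall>z\<in>K. dist y p \<le> dist y z"
    using nearest_point_exists[OF assms] by blast
  then have "\<exists>p. p \<in> K \<and> (\<forall>z. z \<in> K \<longrightarrow> dist y p \<le> dist y z)" by blast
  from someI_ex[OF this] show ?thesis
    unfolding metric_proj_def arg_min_def is_arg_min_linorder by blast
qed

lemma metric_proj_in:
  fixes K :: "'h::{real_inner, banach} set"
  assumes "K \<noteq> {}" "closed K" "convex K"
  shows "metric_proj K y \<in> K"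
  using metric_proj_in_and_nearest[OF assms] by blast

lemma metric_proj_variational:
  fixes K :: "'h::{real_inner, banach} set"
  assumes "K \<noteq> {}" "closed K" "convex K" "z \<in> K"
  shows "(y - metric_proj K y) \<bullet> (z - metric_proj K y) \<le> 0"
  using metric_proj_in_and_nearest[OF assms(1-3), of y] assms
  by (intro any_closest_point_dot[of K]) auto

lemma scaled_defect_in_normal_cone:
  fixes K :: "'h::{real_inner, banach} set"
  assumes "K \<noteq> {}" "closed K" "convex K" "0 \<le> t"
  shows "t *\<^sub>R (y - metric_proj K y) \<in> normal_cone K (metric_proj K y)"
  using metric_proj_in[OF assms(1-3)] metric_proj_variational[OF assms(1-3)] \<open>0 \<le> t\<close>
  by (auto simp: normal_cone_def intro: mult_nonneg_nonpos)

text \<open>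
  This rests on the monotonicity of the normal cone: adding the variational inequalities at the two
  projections shows that the difference of the defects and the difference of the projections have a
  nonnegative inner product. Their sum is \<open>y - z\<close>, so neither of them can be longer than it.
\<close>

lemma defect_nonexpansive:
  fixes K :: "'h::{real_inner, banach} set"
  assumes "K \<noteq> {}" "closed K" "convex K"
  shows "norm ((y - metric_proj K y) - (z - metric_proj K z)) \<le> norm (y - z)"
proof -
  define p q where "p = metric_proj K y" and "q = metric_proj K z"
  define D where "D = (y - p) - (z - q)"
  have "(y - p) \<bullet> (q - p) \<le> 0" "(z - q) \<bullet> (p - q) \<le> 0"
    unfolding p_def q_def
    using metric_proj_variational[OF assms] metric_proj_in[OF assms] by blast+
  then have "D \<bullet> (p - q) \<ge> 0"
    unfolding D_def by (simp add: inner_simps algebra_simps)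
  moreover have "D \<bullet> (y - z) = D \<bullet> D + D \<bullet> (p - q)"
    unfolding D_def by (simp add: inner_simps algebra_simps)
  ultimately have "D \<bullet> D \<le> D \<bullet> (y - z)" by linarith
  also have "\<dots> \<le> norm D * norm (y - z)" by (rule norm_cauchy_schwarz)
  finally have "norm D * norm D \<le> norm D * norm (y - z)"
    by (simp add: norm_eq_sqrt_inner)
  then have "norm D \<le> norm (y - z)"
    by (metis mult_le_cancel_left_pos norm_ge_zero zero_less_norm_iff norm_zero)
  then show ?thesis unfolding D_def p_def q_def .
qed

text \<open>
  Normality of \<open>\<nu>\<close> at \<open>s\<close> is the variational inequality that characterises \<open>P(s + \<nu>)\<close>. Testing this
  inequality for each of the two points with the other one and adding shows that they coincide.
\<close>

lemma metric_proj_add_normal: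
  fixes K :: "'h::{real_inner, banach} set"
  assumes "K \<noteq> {}" "closed K" "convex K" and \<nu>: "\<nu> \<in> normal_cone K s"
  shows "metric_proj K (s + \<nu>) = s"
proof -
  define p where "p = metric_proj K (s + \<nu>)"
  have s: "s \<in> K" and n: "\<And>z. z \<in> K \<Longrightarrow> \<nu> \<bullet> (z - s) \<le> 0"
    using \<nu> by (auto simp: normal_cone_def split: if_splits)
  have "(s + \<nu> - p) \<bullet> (s - p) \<le> 0"
    unfolding p_def by (rule metric_proj_variational[OF assms(1-3) s])
  moreover have "\<nu> \<bullet> (p - s) \<le> 0"
    using n metric_proj_in[OF assms(1-3)] unfolding p_def by blast
  moreover have "(s + \<nu> - p) \<bullet> (s - p) = (s - p) \<bullet> (s - p) - \<nu> \<bullet> (p - s)"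
    by (simp add: inner_simps algebra_simps)
  ultimately have "(s - p) \<bullet> (s - p) \<le> 0" by linarith
  then have "s = p"
    by (metis inner_gt_zero_iff linorder_not_le right_minus_eq)
  then show ?thesis unfolding p_def by simp
qed

text \<open>
  The vector \<open>u - P(u + \<nu>)\<close> is the second part of the residual. It vanishes at \<open>u = s\<close>, and up to
  the constant \<open>\<nu>\<close> it is the nonexpansive defect at \<open>u + \<nu>\<close>.
\<close>

lemma complementarity_defect_le:
  fixes K :: "'h::{real_inner, banach} set"
  assumes "K \<noteq> {}" "closed K" "convex K" "\<nu> \<in> normal_cone K s"
  shows "norm (u - metric_proj K (u + \<nu>)) \<le> norm (u - s)"
  using defect_nonexpansive[OF assms(1-3), of "u + \<nu>" "s + \<nu>"]
    metric_proj_add_normal[OF assms] by simp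


section \<open>The residual near a KKT point\<close>

lemma norm_dual_adjoint_le: "norm (dual_adjoint A l) \<le> norm A * norm l"
proof -
  have "norm (blinfun_inner_right l) \<le> norm l"
    by (rule norm_blinfun_bound) (auto simp: Cauchy_Schwarz_ineq2)
  then show ?thesis
    unfolding dual_adjoint_def
    using norm_blinfun_compose[of "blinfun_inner_right l" A]
    by (smt (verit) mult.commute mult_right_mono norm_ge_zero)
qed

lemma dual_adjoint_scaleR: "dual_adjoint A (t *\<^sub>R l) = t *\<^sub>R dual_adjoint A l"
  by (rule blinfun_eqI) (simp add: dual_adjoint_def blinfun.bilinear_simps)

lemma dual_adjoint_diff:
  "dual_adjoint A l - dual_adjoint B m = dual_adjoint (A - B) l + dual_adjoint B (l - m)"
  by (rule blinfun_eqI)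
    (simp add: dual_adjoint_def minus_blinfun.rep_eq plus_blinfun.rep_eq
      inner_diff_left inner_diff_right)

lemma differentiable_locally_lipschitz_at:
  assumes "(f has_derivative blinfun_apply D) (at a)"
  obtains L d where "0 \<le> L" "0 < d"
    "\<And>x. norm (x - a) < d \<Longrightarrow> norm (f x - f a) \<le> L * norm (x - a)"
proof -
  obtain d where d: "0 < d"
    "\<And>x. norm (x - a) < d \<Longrightarrow> norm (f x - f a - D (x - a)) \<le> 1 * norm (x - a)"
    using assms unfolding has_derivative_at_alt by (meson zero_less_one)
  have "norm (f x - f a) \<le> (1 + norm D) * norm (x - a)" if "norm (x - a) < d" for x
    using d(2)[OF that] norm_blinfun[of D "x - a"]
      norm_triangle_sub[of "f x - f a" "D (x - a)"] by (simp add: algebra_simps)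
  then show thesis
    by (intro that[of "1 + norm D" d]) (use d(1) in auto)
qed

text \<open>
  The residual vanishes at a KKT point and is built from maps that are differentiable there and from
  the nonexpansive defect of the projection.
\<close>

lemma residual_le_distance:
  fixes F :: "'x::real_normed_vector \<Rightarrow> ('x \<Rightarrow>\<^sub>L real)"
    and g :: "'x \<Rightarrow> 'h::{real_inner, banach}"
  assumes K: "K \<noteq> {}" "closed K" "convex K"
    and F: "(F has_derivative blinfun_apply F') (at xbar)"
    and g: "(g has_derivative blinfun_apply (g' xbar)) (at xbar)"
    and g': "(g' has_derivative blinfun_apply g'') (at xbar)"
    and kkt: "KKT_point F g g' K xbar lambar"
  obtains C \<eta> where "0 \<le> C" "0 < \<eta>"
    "\<And>x l. norm (x - xbar) + norm (l - lambar) < \<eta> \<Longrightarrow>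
       residual F g g' K x l \<le> C * (norm (x - xbar) + norm (l - lambar))"
proof -
  obtain LF dF where LF: "0 \<le> LF" "0 < dF"
    "\<And>x. norm (x - xbar) < dF \<Longrightarrow> norm (F x - F xbar) \<le> LF * norm (x - xbar)"
    using differentiable_locally_lipschitz_at[OF F] by blast
  obtain Lg dg where Lg: "0 \<le> Lg" "0 < dg"
    "\<And>x. norm (x - xbar) < dg \<Longrightarrow> norm (g x - g xbar) \<le> Lg * norm (x - xbar)"
    using differentiable_locally_lipschitz_at[OF g] by blast
  obtain Lh dh where Lh: "0 \<le> Lh" "0 < dh"
    "\<And>x. norm (x - xbar) < dh \<Longrightarrow> norm (g' x - g' xbar) \<le> Lh * norm (x - xbar)"
    using differentiable_locally_lipschitz_at[OF g'] by blast
  have L0: "lagr F g' xbar lambar = 0" and nc: "lambar \<in> normal_cone K (g xbar)"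
    using kkt by (auto simp: KKT_point_def)
  define R where "R = norm lambar + 1"
  define C where "C = LF + Lh * R + norm (g' xbar) + Lg + 2"
  have R: "0 \<le> R" by (simp add: R_def)
  \<comment> \<open>The radius 1 keeps the multiplier in the ball of radius \<open>R\<close>, so that the product
      \<open>g'(x)\<^sup>* l\<close> is Lipschitz there.\<close>
  have "residual F g g' K x l \<le> C * (norm (x - xbar) + norm (l - lambar))"
    if e: "norm (x - xbar) + norm (l - lambar) < Min {dF, dg, dh, 1}" for x l
  proof -
    define dx dl where "dx = norm (x - xbar)" and "dl = norm (l - lambar)"
    have nn: "0 \<le> dx" "0 \<le> dl" by (auto simp: dx_def dl_def)
    have small: "dx < dF" "dx < dg" "dx < dh" "dl < 1"
      using e nn unfolding dx_def[symmetric] dl_def[symmetric] by auto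
    have nl: "norm l \<le> R"
      using small(4) norm_triangle_sub[of l lambar] by (simp add: R_def dl_def)
    have "lagr F g' x l = lagr F g' x l - lagr F g' xbar lambar"
      by (simp add: L0)
    also have "\<dots> = (F x - F xbar)
        + (dual_adjoint (g' x) l - dual_adjoint (g' xbar) lambar)"
      by (simp add: lagr_def)
    also have "\<dots> = (F x - F xbar)
        + (dual_adjoint (g' x - g' xbar) l + dual_adjoint (g' xbar) (l - lambar))"
      by (simp only: dual_adjoint_diff)
    also have "norm \<dots> \<le> LF * dx + ((Lh * dx) * R + norm (g' xbar) * dl)"
    proof (intro norm_triangle_mono)
      show "norm (F x - F xbar) \<le> LF * dx"
        using LF(3) small unfolding dx_def by blast
      have "norm (g' x - g' xbar) \<le> Lh * dx"
        using Lh(3) small unfolding dx_def by blast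
      then show "norm (dual_adjoint (g' x - g' xbar) l) \<le> (Lh * dx) * R"
        using nl Lh(1) nn
        by (intro order_trans[OF norm_dual_adjoint_le] mult_mono) auto
      show "norm (dual_adjoint (g' xbar) (l - lambar)) \<le> norm (g' xbar) * dl"
        unfolding dl_def by (rule norm_dual_adjoint_le)
    qed
    finally have A: "norm (lagr F g' x l) \<le> (LF + Lh * R) * dx + norm (g' xbar) * dl"
      by (simp add: algebra_simps)
    have "g x - metric_proj K (g x + l) =
        ((g x + l) - metric_proj K (g x + l)) -
        ((g xbar + lambar) - metric_proj K (g xbar + lambar)) - (l - lambar)"
      using metric_proj_add_normal[OF K nc] by simp
    also have "norm \<dots> \<le> norm (((g x + l) - metric_proj K (g x + l)) -
        ((g xbar + lambar) - metric_proj K (g xbar + lambar))) + dl"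
      unfolding dl_def by (rule norm_triangle_ineq4)
    also have "\<dots> \<le> norm ((g x + l) - (g xbar + lambar)) + dl"
      by (intro add_right_mono defect_nonexpansive K)
    also have "\<dots> = norm ((g x - g xbar) + (l - lambar)) + dl"
      by (simp add: add_diff_add)
    also have "\<dots> \<le> (Lg * dx + dl) + dl"
    proof (intro add_right_mono norm_triangle_mono)
      show "norm (g x - g xbar) \<le> Lg * dx"
        using Lg(3) small unfolding dx_def by blast
    qed (simp add: dl_def)
    finally have B: "norm (g x - metric_proj K (g x + l)) \<le> Lg * dx + 2 * dl" by simp
    have "residual F g g' K x l \<le> (LF + Lh * R + Lg) * dx + (norm (g' xbar) + 2) * dl"
      using A B by (simp add: residual_def algebra_simps)
    also have "\<dots> \<le> C * dx + C * dl"
      using nn LF(1) Lg(1) Lh(1) R unfolding C_def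
      by (intro add_mono[OF mult_right_mono mult_right_mono]) (auto simp: add_increasing)
    finally show ?thesis unfolding dx_def dl_def by (simp add: distrib_left)
  qed
  then show thesis
    using LF(1,2) Lg(1,2) Lh(1,2) R
    by (intro that[of C "Min {dF, dg, dh, 1}"]) (auto simp: C_def)
qed


section \<open>One step of the method\<close>

lemma alm_penalty_pos:
  assumes "alm_sequences F g g' K B \<rho>0 \<gamma> \<tau> x lam w \<rho>"
  shows "0 < \<rho> k"
  using assms by (induction k) (auto simp: alm_sequences_def)

lemma alm_penalty_mono:
  assumes "alm_sequences F g g' K B \<rho>0 \<gamma> \<tau> x lam w \<rho>"
  shows "incseq \<rho>"
proof (rule incseq_SucI)
  fix k
  have "\<rho> (Suc k) = \<rho> k \<or> \<rho> (Suc k) = \<gamma> * \<rho> k" "1 < \<gamma>"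
    using assms by (auto simp: alm_sequences_def)
  then show "\<rho> k \<le> \<rho> (Suc k)"
    using alm_penalty_pos[OF assms, of k] by auto
qed

lemma aug_lagr_eq_lagr:
  assumes "l = \<rho> *\<^sub>R (g x + w /\<^sub>R \<rho> - metric_proj K (g x + w /\<^sub>R \<rho>))"
  shows "aug_lagr F g g' K \<rho> x w = lagr F g' x l"
  by (simp add: assms aug_lagr_def lagr_def dual_adjoint_scaleR)

text \<open>
  Both summands compare separately: the Lagrangian parts agree, and the updated
  multiplier is normal to \<open>K\<close> at the projected point, whose distance to \<open>g x\<close> is the second summand
  of the utility.
\<close>

lemma residual_le_utility:
  fixes g :: "'x::real_normed_vector \<Rightarrow> 'h::{real_inner, banach}"
  assumes K: "K \<noteq> {}" "closed K" "convex K" and "0 < \<rho>"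
    and l: "l = \<rho> *\<^sub>R (g x + w /\<^sub>R \<rho> - metric_proj K (g x + w /\<^sub>R \<rho>))"
  shows "residual F g g' K x l \<le> utility F g g' K x w \<rho>"
proof -
  have "aug_lagr F g g' K \<rho> x w = lagr F g' x l"
    using l by (rule aug_lagr_eq_lagr)
  moreover have "l \<in> normal_cone K (metric_proj K (g x + w /\<^sub>R \<rho>))"
    unfolding l using \<open>0 < \<rho>\<close> by (intro scaled_defect_in_normal_cone K) simp
  ultimately show ?thesis
    using complementarity_defect_le[OF K] by (simp add: residual_def utility_def)
qed

lemma utility_eq:
  fixes g :: "'x::real_normed_vector \<Rightarrow> 'h::{real_inner, banach}"
  assumes "0 < \<rho>" and l: "l = \<rho> *\<^sub>R (g x + w /\<^sub>R \<rho> - metric_proj K (g x + w /\<^sub>R \<rho>))"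
  shows "utility F g g' K x w \<rho> = norm (aug_lagr F g g' K \<rho> x w) + norm (l - w) / \<rho>"
proof -
  have "l - w = \<rho> *\<^sub>R (g x - metric_proj K (g x + w /\<^sub>R \<rho>))"
    using \<open>0 < \<rho>\<close> by (simp add: l algebra_simps)
  then show ?thesis
    using \<open>0 < \<rho>\<close> by (simp add: utility_def)
qed

lemma alm_residual_le_utility:
  fixes g :: "'x::real_normed_vector \<Rightarrow> 'h::{real_inner, banach}"
  assumes "K \<noteq> {}" "closed K" "convex K"
    and alm: "alm_sequences F g g' K B \<rho>0 \<gamma> \<tau> x lam w \<rho>"
  shows "residual F g g' K (x (Suc k)) (lam (Suc k)) \<le> utility F g g' K (x (Suc k)) (w k) (\<rho> k)"
  using alm by (intro residual_le_utility assms alm_penalty_pos[OF alm])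
    (auto simp: alm_sequences_def)

text \<open>
  The inexactness condition controls the Lagrangian part of the utility; the multiplier step, once
  \<open>w\<^sup>k = \<lambda>\<^sup>k\<close>, is bounded by the two successive distances to the solution.
\<close>

lemma utility_le:
  fixes g :: "'x::real_normed_vector \<Rightarrow> 'h::{real_inner, banach}"
  assumes alm: "alm_sequences F g g' K B \<rho>0 \<gamma> \<tau> x lam w \<rho>"
    and asm: "alm_assumptions F g g' K xbar lambar x lam w \<rho>"
  obtains z where "z \<longlonglongrightarrow> 0" "\<And>k. 0 \<le> z k"
    "\<forall>\<^sub>F k in sequentially. utility F g g' K (x (Suc k)) (w k) (\<rho> k)
       \<le> z k * residual F g g' K (x k) (lam k) +
         ((norm (x k - xbar) + norm (lam k - lambar)) +
          (norm (x (Suc k) - xbar) + norm (lam (Suc k) - lambar))) / \<rho> k"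
proof -
  from asm obtain \<epsilon> z where z: "z \<longlonglongrightarrow> 0" "\<And>k. 0 \<le> z k"
    and \<epsilon>: "\<And>k. norm (aug_lagr F g g' K (\<rho> k) (x (Suc k)) (w k)) \<le> \<epsilon> (Suc k)"
    and small: "\<forall>\<^sub>F k in sequentially. \<epsilon> (Suc k) \<le> z k * residual F g g' K (x k) (lam k)"
    and w: "\<forall>\<^sub>F k in sequentially. w k = lam k"
    unfolding alm_assumptions_def by blast
  show thesis
  proof (rule that[OF z])
    show "\<forall>\<^sub>F k in sequentially. utility F g g' K (x (Suc k)) (w k) (\<rho> k)
       \<le> z k * residual F g g' K (x k) (lam k) +
         ((norm (x k - xbar) + norm (lam k - lambar)) +
          (norm (x (Suc k) - xbar) + norm (lam (Suc k) - lambar))) / \<rho> k"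
      using small w
    proof eventually_elim
      case (elim k)
      note pos = alm_penalty_pos[OF alm, of k]
      have "utility F g g' K (x (Suc k)) (w k) (\<rho> k) =
          norm (aug_lagr F g g' K (\<rho> k) (x (Suc k)) (w k)) + norm (lam (Suc k) - w k) / \<rho> k"
        using alm by (intro utility_eq[OF pos]) (auto simp: alm_sequences_def)
      moreover have "norm (lam (Suc k) - w k) \<le>
          (norm (x k - xbar) + norm (lam k - lambar)) +
          (norm (x (Suc k) - xbar) + norm (lam (Suc k) - lambar))"
        using norm_triangle_ineq4[of "lam (Suc k) - lambar" "lam k - lambar"]
          norm_ge_zero[of "x k - xbar"] norm_ge_zero[of "x (Suc k) - xbar"]
        unfolding elim(2) diff_diff_eq2 diff_add_cancel by linarith
      ultimately show ?case
        using \<epsilon>[of k] elim(1) pos by (smt (verit) divide_right_mono)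
    qed
  qed
qed

lemma alm_tendsto:
  assumes "alm_assumptions F g g' K xbar lambar x lam w \<rho>"
  shows "(\<lambda>k. norm (x k - xbar) + norm (lam k - lambar)) \<longlonglongrightarrow> 0"
proof -
  have "(\<lambda>k. (x k, lam k)) \<longlonglongrightarrow> (xbar, lambar)"
    using assms by (simp add: alm_assumptions_def)
  from tendsto_fst[OF this] tendsto_snd[OF this]
  have "(\<lambda>k. x k - xbar) \<longlonglongrightarrow> 0" "(\<lambda>k. lam k - lambar) \<longlonglongrightarrow> 0"
    by (auto simp: LIM_zero)
  from tendsto_add[OF tendsto_norm_zero[OF this(1)] tendsto_norm_zero[OF this(2)]]
  show ?thesis by simp
qed

text \<open>
  Convergence of the iterates is what makes the local hypotheses applicable: the upper Lipschitz
  bound first forces the residuals to tend to zero, after which the error bound holds along the tail.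
\<close>

lemma eventually_error_bounds:
  assumes conv: "(\<lambda>k. norm (x k - xbar) + norm (lam k - lambar)) \<longlonglongrightarrow> 0"
    and C: "0 < \<eta>" "\<And>x l. norm (x - xbar) + norm (l - lambar) < \<eta> \<Longrightarrow>
       residual F g g' K x l \<le> C * (norm (x - xbar) + norm (l - lambar))"
    and c: "0 < \<delta>" "\<And>x l. norm (x - xbar) < \<delta> \<Longrightarrow> residual F g g' K x l < \<delta> \<Longrightarrow>
       norm (x - xbar) + norm (l - lambar) \<le> c * residual F g g' K x l"
  shows "\<forall>\<^sub>F k in sequentially.
      residual F g g' K (x k) (lam k) \<le> C * (norm (x k - xbar) + norm (lam k - lambar)) \<and>
      norm (x k - xbar) + norm (lam k - lambar) \<le> c * residual F g g' K (x k) (lam k)"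
proof -
  have "(\<lambda>k. C * (norm (x k - xbar) + norm (lam k - lambar))) \<longlonglongrightarrow> 0"
    using tendsto_mult_right_zero[OF conv] .
  from order_tendstoD(2)[OF conv C(1)] order_tendstoD(2)[OF conv c(1)] order_tendstoD(2)[OF this c(1)]
  show ?thesis
  proof eventually_elim
    case (elim k)
    have "residual F g g' K (x k) (lam k) \<le> C * (norm (x k - xbar) + norm (lam k - lambar))"
      using C(2) elim(1) .
    moreover from this have "residual F g g' K (x k) (lam k) < \<delta>"
      using elim(3) by linarith
    moreover have "norm (x k - xbar) < \<delta>"
      using elim(2) norm_ge_zero[of "lam k - lambar"] by linarith
    ultimately show ?case using c(2) by blast
  qed
qed


section \<open>Convergence rate and boundedness of the penalty parameters\<close>

text \<open>
  The requirement \<open>c/\<rho> \<le> q/4\<close> leaves the factor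
  \<open>1 - q/4 \<ge> 1/2\<close> on the left after absorbing the new error, while the right-hand side
  eventually has the factor \<open>q/4 + q/4\<close>.
\<close>

lemma linear_rate_recursion:
  fixes e \<sigma> V z \<rho> :: "nat \<Rightarrow> real"
  assumes q: "0 < q" "q < 1" and c: "0 < c" and C: "0 \<le> C"
    and z: "z \<longlonglongrightarrow> 0" "\<And>k. 0 \<le> z k" and e: "\<And>k. 0 \<le> e k"
    and bounds: "\<forall>\<^sub>F k in sequentially. \<sigma> k \<le> C * e k \<and> e k \<le> c * \<sigma> k"
    and low: "\<And>k. \<sigma> (Suc k) \<le> V (Suc k)"
    and up: "\<forall>\<^sub>F k in sequentially. V (Suc k) \<le> z k * \<sigma> k + (e k + e (Suc k)) / \<rho> k"
    and \<rho>: "\<forall>\<^sub>F k in sequentially. 4 * c / q \<le> \<rho> k"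
  shows "\<forall>\<^sub>F k in sequentially. e (Suc k) \<le> q * e k"
proof -
  have "(\<lambda>k. c * C * z k) \<longlonglongrightarrow> 0"
    by (rule tendsto_mult_right_zero[OF z(1)])
  from order_tendstoD(2)[OF this, of "q/4"] q
  have "\<forall>\<^sub>F k in sequentially. c * C * z k < q/4" by simp
  moreover have "\<forall>\<^sub>F k in sequentially. \<sigma> (Suc k) \<le> C * e (Suc k) \<and> e (Suc k) \<le> c * \<sigma> (Suc k)"
    using bounds by (subst eventually_sequentially_Suc)
  ultimately show ?thesis using bounds up \<rho>
  proof eventually_elim
    case (elim k)
    have "0 < 4 * c / q" using c q by simp
    then have pos: "0 < \<rho> k" using elim(5) by linarith
    have r: "c / \<rho> k \<le> q / 4"
      using elim(5) pos q by (simp add: field_simps)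
    have "e (Suc k) \<le> c * \<sigma> (Suc k)" using elim(2) by blast
    also have "\<dots> \<le> c * (z k * \<sigma> k + (e k + e (Suc k)) / \<rho> k)"
      using low[of k] elim(4) c by (intro mult_left_mono) auto
    also have "\<dots> \<le> c * (z k * (C * e k) + (e k + e (Suc k)) / \<rho> k)"
      using elim(3) c z(2)[of k] by (intro mult_left_mono add_right_mono) auto
    also have "\<dots> = (c * C * z k) * e k + (c / \<rho> k) * (e k + e (Suc k))"
      by (simp add: algebra_simps add_divide_distrib)
    also have "\<dots> \<le> (q/4) * e k + (q/4) * (e k + e (Suc k))"
      using elim(1) r e[of k] e[of "Suc k"] by (intro add_mono mult_right_mono) auto
    finally have *: "e (Suc k) \<le> (q/2) * e k + (q/4) * e (Suc k)"
      by (simp add: algebra_simps add_divide_distrib)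
    have "(q/4) * e (Suc k) \<le> (1/2) * e (Suc k)"
      using q e[of "Suc k"] by (intro mult_right_mono) auto
    then show ?case using * by linarith
  qed
qed

text \<open>
  If the penalty parameters diverge, the rate recursion makes the errors nonincreasing, and the
  utility is then multiplied by a vanishing factor in each step.
\<close>

lemma utility_reduction:
  fixes e \<sigma> V z \<rho> :: "nat \<Rightarrow> real"
  assumes \<tau>: "0 < \<tau>" and c: "0 < c" and C: "0 \<le> C"
    and z: "z \<longlonglongrightarrow> 0" "\<And>k. 0 \<le> z k" and e: "\<And>k. 0 \<le> e k"
    and \<sigma>: "\<And>k. 0 \<le> \<sigma> k"
    and bounds: "\<forall>\<^sub>F k in sequentially. \<sigma> k \<le> C * e k \<and> e k \<le> c * \<sigma> k"
    and low: "\<And>k. \<sigma> (Suc k) \<le> V (Suc k)"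
    and up: "\<forall>\<^sub>F k in sequentially. V (Suc k) \<le> z k * \<sigma> k + (e k + e (Suc k)) / \<rho> k"
    and \<rho>: "filterlim \<rho> at_top sequentially"
  shows "\<forall>\<^sub>F k in sequentially. V (Suc k) \<le> \<tau> * V k"
proof -
  have ge: "\<forall>\<^sub>F k in sequentially. M \<le> \<rho> k" for M
    using \<rho> by (simp add: filterlim_at_top)
  have dec: "\<forall>\<^sub>F k in sequentially. e (Suc k) \<le> (1/2) * e k"
    by (rule linear_rate_recursion[OF _ _ c C z e bounds low up]) (use ge in auto)
  have lowk: "\<forall>\<^sub>F k in sequentially. \<sigma> k \<le> V k"
    by (subst eventually_sequentially_Suc[symmetric]) (simp add: low)
  have "\<forall>\<^sub>F k in sequentially. z k < \<tau>/2"
    using order_tendstoD(2)[OF z(1), of "\<tau>/2"] \<tau> by simp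
  then show ?thesis using bounds up dec lowk ge[of "4 * c / \<tau>"]
  proof eventually_elim
    case (elim k)
    have "0 < 4 * c / \<tau>" using c \<tau> by simp
    then have pos: "0 < \<rho> k" using elim(6) by linarith
    have r: "2 * c / \<rho> k \<le> \<tau> / 2"
      using elim(6) pos \<tau> by (simp add: field_simps)
    have "e k + e (Suc k) \<le> 2 * (c * \<sigma> k)"
      using elim(2,4) e[of k] by linarith
    then have "(e k + e (Suc k)) / \<rho> k \<le> (2 * c / \<rho> k) * \<sigma> k"
      using pos by (simp add: divide_right_mono)
    also have "\<dots> \<le> (\<tau>/2) * \<sigma> k"
      using r \<sigma>[of k] by (rule mult_right_mono)
    finally have "(e k + e (Suc k)) / \<rho> k \<le> (\<tau>/2) * \<sigma> k" .
    moreover have "z k * \<sigma> k \<le> (\<tau>/2) * \<sigma> k"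
      using elim(1) \<sigma>[of k] by (intro mult_right_mono) auto
    ultimately have "V (Suc k) \<le> \<tau> * \<sigma> k" using elim(3) by linarith
    also have "\<dots> \<le> \<tau> * V k" using elim(5) \<tau> by simp
    finally show ?case .
  qed
qed

theorem theorem6p4:
  fixes F :: "'x::banach \<Rightarrow> ('x \<Rightarrow>\<^sub>L real)"
    and g :: "'x \<Rightarrow> 'h::{real_inner, banach}"
    and g' :: "'x \<Rightarrow> ('x \<Rightarrow>\<^sub>L 'h)"
    and K :: "'h set"
    and xbar :: 'x and lambar :: 'h
  assumes "K \<noteq> {}" and "closed K" and "convex K"
    and "continuously_differentiable F"
    and "\<And>x. (g has_derivative blinfun_apply (g' x)) (at x)"
    and "continuously_differentiable g'"
    and "KKT_point F g g' K xbar lambar"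
    and "local_error_bound F g g' K xbar lambar"
  shows "(\<forall>q::real. 0 < q \<and> q < 1 \<longrightarrow>
            (\<exists>\<rho>q>0. \<forall>B \<rho>0 \<gamma> \<tau> x lam w \<rho>.
               alm_sequences F g g' K B \<rho>0 \<gamma> \<tau> x lam w \<rho> \<longrightarrow>
               alm_assumptions F g g' K xbar lambar x lam w \<rho> \<longrightarrow>
               (\<forall>\<^sub>F k in sequentially. \<rho> k \<ge> \<rho>q) \<longrightarrow>
               Q_linear_rate q x lam xbar lambar))
         \<and> (\<forall>B \<rho>0 \<gamma> \<tau> x lam w \<rho>.
               alm_sequences F g g' K B \<rho>0 \<gamma> \<tau> x lam w \<rho> \<longrightarrow>
               alm_assumptions F g g' K xbar lambar x lam w \<rho> \<longrightarrow>
               bounded (range \<rho>))"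
proof -
  note K = \<open>K \<noteq> {}\<close> \<open>closed K\<close> \<open>convex K\<close>
  obtain F' where "\<And>x. (F has_derivative blinfun_apply (F' x)) (at x)"
    using \<open>continuously_differentiable F\<close> unfolding continuously_differentiable_def by blast
  moreover obtain g'' where "\<And>x. (g' has_derivative blinfun_apply (g'' x)) (at x)"
    using \<open>continuously_differentiable g'\<close> unfolding continuously_differentiable_def by blast
  ultimately obtain C \<eta> where C: "0 \<le> C" "0 < \<eta>"
    "\<And>x l. norm (x - xbar) + norm (l - lambar) < \<eta> \<Longrightarrow>
       residual F g g' K x l \<le> C * (norm (x - xbar) + norm (l - lambar))"
    using residual_le_distance[OF K _ assms(5) _ assms(7)] by metis
  obtain c \<delta> where c: "0 < c" "0 < \<delta>"
    "\<And>x l. norm (x - xbar) < \<delta> \<Longrightarrow> residual F g g' K x l < \<delta> \<Longrightarrow>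
       norm (x - xbar) + norm (l - lambar) \<le> c * residual F g g' K x l"
    using \<open>local_error_bound F g g' K xbar lambar\<close> unfolding local_error_bound_def by blast
  have rate: "Q_linear_rate q x lam xbar lambar"
    if q: "0 < q" "q < 1" and alm: "alm_sequences F g g' K B \<rho>0 \<gamma> \<tau> x lam w \<rho>"
      and asm: "alm_assumptions F g g' K xbar lambar x lam w \<rho>"
      and large: "\<forall>\<^sub>F k in sequentially. 4 * c / q \<le> \<rho> k"
    for q \<rho>0 \<gamma> \<tau> :: real and B x lam w \<rho>
  proof -
    obtain z where z: "z \<longlonglongrightarrow> 0" "\<And>k. 0 \<le> z k"
      and up: "\<forall>\<^sub>F k in sequentially. utility F g g' K (x (Suc k)) (w k) (\<rho> k)
       \<le> z k * residual F g g' K (x k) (lam k) +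
         ((norm (x k - xbar) + norm (lam k - lambar)) +
          (norm (x (Suc k) - xbar) + norm (lam (Suc k) - lambar))) / \<rho> k"
      using utility_le[OF alm asm] by blast
    show ?thesis
      unfolding Q_linear_rate_def
      by (rule linear_rate_recursion[OF q c(1) C(1) z,
            where V = "\<lambda>k. utility F g g' K (x k) (w (k - 1)) (\<rho> (k - 1))"
              and \<sigma> = "\<lambda>k. residual F g g' K (x k) (lam k)"])
        (use up large eventually_error_bounds[OF alm_tendsto[OF asm] C(2,3) c(2,3)]
          alm_residual_le_utility[OF K alm] in auto)
  qed
  have bdd: "bounded (range \<rho>)"
    if alm: "alm_sequences F g g' K B \<rho>0 \<gamma> \<tau> x lam w \<rho>"
      and asm: "alm_assumptions F g g' K xbar lambar x lam w \<rho>"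
    for \<rho>0 \<gamma> \<tau> :: real and B x lam w \<rho>
  proof (rule ccontr)
    assume unb: "\<not> bounded (range \<rho>)"
    note mono = alm_penalty_mono[OF alm]
    have "\<exists>k. M < \<rho> k" for M
    proof (rule ccontr)
      assume "\<nexists>k. M < \<rho> k"
      then have "\<rho> k \<in> {0..M}" for k
        using less_imp_le[OF alm_penalty_pos[OF alm, of k]] by (simp add: not_less)
      then have "range \<rho> \<subseteq> {0..M}" by blast
      then show False using unb bounded_subset bounded_closed_interval by blast
    qed
    then have div: "filterlim \<rho> at_top sequentially"
      using mono unfolding filterlim_at_top eventually_sequentially
      by (meson incseqD less_imp_le order_trans)
    obtain z where z: "z \<longlonglongrightarrow> 0" "\<And>k. 0 \<le> z k"
      and up: "\<forall>\<^sub>F k in sequentially. utility F g g' K (x (Suc k)) (w k) (\<rho> k)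
       \<le> z k * residual F g g' K (x k) (lam k) +
         ((norm (x k - xbar) + norm (lam k - lambar)) +
          (norm (x (Suc k) - xbar) + norm (lam (Suc k) - lambar))) / \<rho> k"
      using utility_le[OF alm asm] by blast
    \<comment> \<open>The iterate \<open>x k\<close> stems from step \<open>k - 1\<close>; with this shift the update test of the method reads
        \<open>V (Suc k) \<le> \<tau> * V k\<close> for \<open>k > 0\<close>, and at \<open>k = 0\<close> the parameter is kept in any case.\<close>
    define V where "V k = utility F g g' K (x k) (w (k - 1)) (\<rho> (k - 1))" for k
    have \<tau>: "0 < \<tau>" using alm by (simp add: alm_sequences_def)
    have "\<forall>\<^sub>F k in sequentially. V (Suc k) \<le> \<tau> * V k"
      by (rule utility_reduction[OF \<tau> c(1) C(1) z,
            where e = "\<lambda>k. norm (x k - xbar) + norm (lam k - lambar)"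
              and \<sigma> = "\<lambda>k. residual F g g' K (x k) (lam k)"])
        (use up div eventually_error_bounds[OF alm_tendsto[OF asm] C(2,3) c(2,3)]
          alm_residual_le_utility[OF K alm] in \<open>auto simp: V_def residual_def\<close>)
    then obtain N where N: "\<And>k. N \<le> k \<Longrightarrow> V (Suc k) \<le> \<tau> * V k"
      by (auto simp: eventually_sequentially)
    have step: "\<rho> (Suc k) = \<rho> k" if "N \<le> k" for k
      using alm N[OF that] by (auto simp: alm_sequences_def V_def)
    have const: "\<rho> k = \<rho> N" if "N \<le> k" for k
      using that by (induction rule: dec_induct) (auto simp: step)
    obtain k where "\<rho> N < \<rho> k" using \<open>\<And>M. \<exists>k. M < \<rho> k\<close> by blast
    then show False
      using const[of k] incseqD[OF mono, of k N] by (cases "N \<le> k") auto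
  qed
  show ?thesis
  proof (intro conjI allI impI)
    fix q :: real
    assume q: "0 < q \<and> q < 1"
    have "0 < 4 * c / q" using q c(1) by simp
    then show "\<exists>\<rho>q>0. \<forall>B \<rho>0 \<gamma> \<tau> x lam w \<rho>.
               alm_sequences F g g' K B \<rho>0 \<gamma> \<tau> x lam w \<rho> \<longrightarrow>
               alm_assumptions F g g' K xbar lambar x lam w \<rho> \<longrightarrow>
               (\<forall>\<^sub>F k in sequentially. \<rho> k \<ge> \<rho>q) \<longrightarrow>
               Q_linear_rate q x lam xbar lambar"
      using rate q by blast
  qed (rule bdd)
qed

end
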